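(* Let $\mathbf Y=\boldsymbol\Gamma(\mathbf Y)$ be an elementary system of $k$ set-equations. Then: (a) There is a unique solution $\mathbf T\in\mathrm{Su}(\mathbb P)^k$, and for every $\mathbf A\in\mathrm{Su}(\mathbb P)^k$, $\mathbf T=\lim_{n\to\infty}\boldsymbol\Gamma^{(n)}(\mathbf A)$, meaning: for every $M$ there is $n_0$ such that for all $n\ge n_0$ and all $i$, $\Gamma^{(n)}_{\ i}(\mathbf A)\cap[0,M]=T_i\cap[0,M]$. (b) $T_i=\emptyset$ iff $\Gamma^{(k)}_{\ i}(\boldsymbol\emptyset)=\emptyset$. Assume in addition that the system is reduced. Then: (c) If $[i]\neq\emptyset$ then $T_i$ is periodic. If moreover there are $j\in[i]$ and $\mathbf u\in\mathbb N^k$ with $\Gamma_{j,\mathbf u}\neq\emptyset$ and $\sum_{\ell\in[i]}u_\ell\ge 2$, then $T_i$ is the union of a finite set and a single arithmetical progression. (d) Let "P" mean either "periodic" throughout or "eventually periodic" throughout. Suppose $[i]=\emptyset$ and the $i$th equation can be written as $\Gamma_i(\mathbf Y)=P_i+\bigcup_{Q\in\mathfrak Q_i}\sum_{j=1}^kQ_j\star Y_j$ for all $\mathbf Y$, where $P_i\subseteq\mathbb N$ is P and $\mathfrak Q_i$ is a finite set of $k$-tuples $Q=(Q_1,\dots,Q_k)$ of P subsets of $\mathbb N$, and suppose $T_j$ is P for every $j$ with $i\to j$. Then $T_i$ is P. (e) With $\mathfrak m_i=\mathfrak m(T_i)$, $\boldsymbol{\mathfrak m}=(\mathfrak m_1,\dots,\mathfrak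 m_k)$ and $\mathfrak q_i=\mathfrak q(T_i)$: $$\mathfrak m_i=\min\Gamma^{(k)}_{\ i}(\boldsymbol\emptyset),\qquad \mathfrak q_i=\gcd\Big(\bigcup_{j:\,i\to^\star j}\ \bigcup_{\mathbf u\in\mathbb N^k}\big(\Gamma_{j,\mathbf u}+\textstyle\sum_{\ell=1}^k u_\ell\mathfrak m_\ell-\mathfrak m_j\big)\Big).$$ (f) $\mathfrak q_i\mid\mathfrak q_j$ whenever $i\to j$.
   Context: $\mathbb N=\{0,1,\dots\}$, $\mathbb P=\{1,2,\dots\}$, $\mathrm{Su}(X)$ the set of subsets of $X$. For $A,B\subseteq\mathbb N$: $A+B=\{a+b\}$ (empty if either is empty), $c+B=\{c+b\}$; $n\star B=\{0\}$ if $n=0$ and $B+\cdots+B$ ($n$ copies) if $n\ge1$. For $\mathbf u\in\mathbb N^k$, $\mathbf u\star\mathbf Y=u_1\star Y_1+\cdots+u_k\star Y_k$. A system of set-equations is $\mathbf Y=\boldsymbol\Gamma(\mathbf Y)$ with $\Gamma_i(\mathbf Y)=\bigcup_{\mathbf u\in\mathbb N^k}(\Gamma_{i,\mathbf u}+\mathbf u\star\mathbf Y)$, $1\le i\le k$, for fixed $\Gamma_{i,\mathbf u}\subseteq\mathbb N$. It is basic if $\boldsymbol\Gamma$ maps $\mathrm{Su}(\mathbb P)^k$ into itself (equivalently $0\notin\Gamma_{i,\mathbf 0}$ for all $i$); elementary if it is basic and $0\in\Gamma_{i,\mathbf u}$ implies $\sum_j u_j\ge2$; reduced elementary if moreover no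 coordinate of $\boldsymbol\Gamma^{(k)}(\boldsymbol\emptyset)$ is empty. $\boldsymbol\Gamma^{(n)}$ is the $n$-fold composition, $\Gamma^{(n)}_{\ i}$ its $i$th component, $\boldsymbol\emptyset=(\emptyset,\dots,\emptyset)$. Dependency digraph: vertices $1,\dots,k$, edge $i\to j$ iff there is $\mathbf u$ with $\Gamma_{i,\mathbf u}\neq\emptyset$ and $u_j>0$; $\to^+$ is its transitive closure, $\to^\star$ its reflexive-transitive closure, and $[i]=\{j:i\to^+j\to^+i\}$. A set $A\subseteq\mathbb N$ is periodic if $p+A\subseteq A$ for some positive integer $p$, eventually periodic if for some positive $p$ and some $m$, $a\in A,a\ge m\Rightarrow a+p\in A$. An arithmetical progression is a set $a+b\mathbb N$ with $a\in\mathbb N$, $b\ge1$. For non-empty $A$, $\mathfrak m(A)=\min A$, $\mathfrak q(A)=\gcd\{a-\min A:a\in A\}$ with $\gcd\{0\}=0$; the gcd in (e) is of a set of integers. *)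

theory Defs
  imports "HOL-Library.Set_Algebras" "HOL-Library.Cardinality"
begin

text \<open>
  Sets of naturals carry the sumset operation \<open>A + B\<close> of Set_Algebras, whose neutral element is
  \<open>{0}\<close>. A system of \<open>k\<close> equations is indexed by a finite type with \<open>k\<close> elements and given by its
  coefficient sets \<open>G i u = \<Gamma>\<^sub>i\<^sub>,\<^sub>u\<close>.
\<close>

type_synonym 'k system = "'k \<Rightarrow> ('k \<Rightarrow> nat) \<Rightarrow> nat set"

primrec nstar :: "nat \<Rightarrow> nat set \<Rightarrow> nat set" where
  "nstar 0 B = {0}"
| "nstar (Suc n) B = B + nstar n B"

definition set_star :: "nat set \<Rightarrow> nat set \<Rightarrow> nat set" where
  "set_star Q B = (\<Union>q\<in>Q. nstar q B)"

definition vec_star :: "('k::finite \<Rightarrow> nat) \<Rightarrow> ('k \<Rightarrow> nat set) \<Rightarrow> nat set" where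
  "vec_star u Y = (\<Sum>j\<in>UNIV. nstar (u j) (Y j))"

definition Gam :: "'k::finite system \<Rightarrow> ('k \<Rightarrow> nat set) \<Rightarrow> ('k \<Rightarrow> nat set)" where
  "Gam G Y = (\<lambda>i. \<Union>u. G i u + vec_star u Y)"

definition SuP :: "('k \<Rightarrow> nat set) set" where
  "SuP = {Y. \<forall>i. Y i \<subseteq> {1..}}"

definition basic_system :: "'k::finite system \<Rightarrow> bool" where
  "basic_system G \<longleftrightarrow> Gam G ` SuP \<subseteq> SuP"

definition elementary_system :: "'k::finite system \<Rightarrow> bool" where
  "elementary_system G \<longleftrightarrow>
     basic_system G \<and> (\<forall>i u. 0 \<in> G i u \<longrightarrow> (\<Sum>j\<in>UNIV. u j) \<ge> 2)"

definition reduced_elementary_system :: "'k::finite system \<Rightarrow> bool" where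
  "reduced_elementary_system G \<longleftrightarrow>
     elementary_system G \<and> (\<forall>i. (Gam G ^^ CARD('k)) (\<lambda>_. {}) i \<noteq> {})"

definition solution :: "'k::finite system \<Rightarrow> ('k \<Rightarrow> nat set) \<Rightarrow> bool" where
  "solution G T \<longleftrightarrow> T \<in> SuP \<and> T = Gam G T"

definition dep :: "'k system \<Rightarrow> ('k \<times> 'k) set" where
  "dep G = {(i, j). \<exists>u. G i u \<noteq> {} \<and> u j > 0}"

definition strong_class :: "'k system \<Rightarrow> 'k \<Rightarrow> 'k set" where
  "strong_class G i = {j. (i, j) \<in> (dep G)\<^sup>+ \<and> (j, i) \<in> (dep G)\<^sup>+}"

definition periodic :: "nat set \<Rightarrow> bool" where
  "periodic A \<longleftrightarrow> (\<exists>p>0. \<forall>a\<in>A. p + a \<in> A)"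

definition eventually_periodic :: "nat set \<Rightarrow> bool" where
  "eventually_periodic A \<longleftrightarrow> (\<exists>p>0. \<exists>m. \<forall>a\<in>A. a \<ge> m \<longrightarrow> a + p \<in> A)"

definition arith_progression :: "nat set \<Rightarrow> bool" where
  "arith_progression A \<longleftrightarrow> (\<exists>a b. b \<ge> 1 \<and> A = {a + b * n | n. True})"

definition min_elem :: "nat set \<Rightarrow> nat" where
  "min_elem A = (LEAST a. a \<in> A)"

definition gap_gcd :: "nat set \<Rightarrow> nat" where
  "gap_gcd A = Gcd ((\<lambda>a. a - min_elem A) ` A)"

end

theory Submission imports Defs begin

text \<open>
  In an elementary system every summand of a produced number is strictly smaller than that number,
  so \<open>Gam G\<close> contracts on initial segments, and the minima of the solution are built from strictly
  smaller minima, hence appear within \<open>k\<close> steps.  If all components are nonempty, an edge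
  \<open>i \<rightarrow> j\<close> gives \<open>c + T j \<subseteq> T i\<close> with \<open>c > 0\<close>: cycles yield periods, divisibility of the gap gcds
  propagates along edges, and a branching inside a strong class gives \<open>c + T i + T i \<subseteq> T i\<close>, so that
  \<open>c + T i\<close> is an additive semigroup.
\<close>

section \<open>Sumsets and the operator in terms of explicit summands\<close>

lemma nstar_iff_list: "x \<in> nstar n B \<longleftrightarrow> (\<exists>xs. length xs = n \<and> set xs \<subseteq> B \<and> sum_list xs = x)"
proof (induction n arbitrary: x)
  case 0
  then show ?case by auto
next
  case (Suc n)
  show ?case
  proof
    assume "x \<in> nstar (Suc n) B"
    then obtain b y where "b \<in> B" "y \<in> nstar n B" "x = b + y"
      by (auto elim: set_plus_elim)
    moreover from this obtain xs where "length xs = n" "set xs \<subseteq> B" "sum_list xs = y"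
      using Suc by blast
    ultimately show "\<exists>xs. length xs = Suc n \<and> set xs \<subseteq> B \<and> sum_list xs = x"
      by (intro exI[of _ "b # xs"]) auto
  next
    assume "\<exists>xs. length xs = Suc n \<and> set xs \<subseteq> B \<and> sum_list xs = x"
    then obtain b xs where "length xs = n" "b \<in> B" "set xs \<subseteq> B" "x = b + sum_list xs"
      by (auto simp: length_Suc_conv)
    then show "x \<in> nstar (Suc n) B"
      using Suc by auto
  qed
qed

text \<open>Makes the individual summands available, so that each can be compared with the total or
  replaced by another element of its component.\<close>

lemma vec_star_iff_lists:
  "x \<in> vec_star u Y \<longleftrightarrow>
    (\<exists>xs. (\<forall>l. length (xs l) = u l \<and> set (xs l) \<subseteq> Y l) \<and> x = (\<Sum>l\<in>UNIV. sum_list (xs l)))"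
    (is "_ \<longleftrightarrow> ?R")
proof
  assume "x \<in> vec_star u Y"
  then obtain s where s: "x = sum s UNIV" "\<forall>l. s l \<in> nstar (u l) (Y l)"
    by (auto simp: vec_star_def set_sum_alt)
  then have "\<forall>l. \<exists>xs. length xs = u l \<and> set xs \<subseteq> Y l \<and> sum_list xs = s l"
    using nstar_iff_list by metis
  then obtain xs where "\<forall>l. length (xs l) = u l \<and> set (xs l) \<subseteq> Y l \<and> sum_list (xs l) = s l"
    by metis
  then show ?R
    using s by (intro exI[of _ xs]) simp
next
  assume ?R
  then show "x \<in> vec_star u Y"
    by (auto simp: vec_star_def set_sum_alt nstar_iff_list)
qed

lemma mem_Gam_iff:
  "n \<in> Gam G Y i \<longleftrightarrow> (\<exists>u g w. g \<in> G i u \<and> w \<in> vec_star u Y \<and> n = g + w)"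
  by (fastforce simp: Gam_def set_plus_def)

lemma mem_GamI: "g \<in> G i u \<Longrightarrow> w \<in> vec_star u Y \<Longrightarrow> g + w \<in> Gam G Y i"
  by (auto simp: mem_Gam_iff)

lemma vec_star_mono:
  assumes "\<And>l. u l > 0 \<Longrightarrow> Y l \<subseteq> Z l"
  shows "vec_star u Y \<subseteq> vec_star u Z"
proof
  fix x assume "x \<in> vec_star u Y"
  then obtain xs where xs: "\<forall>l. length (xs l) = u l \<and> set (xs l) \<subseteq> Y l"
      "x = (\<Sum>l\<in>UNIV. sum_list (xs l))"
    unfolding vec_star_iff_lists by blast
  have "set (xs l) \<subseteq> Z l" for l
    using spec[OF xs(1), of l] assms[of l] by (cases "u l = 0") auto
  then show "x \<in> vec_star u Z"
    using xs unfolding vec_star_iff_lists by blast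
qed

lemma Gam_mono: "mono (Gam G)"
proof (intro monoI le_funI subsetI)
  fix Y Z :: "'a \<Rightarrow> nat set" and i n
  assume "Y \<le> Z" "n \<in> Gam G Y i"
  then show "n \<in> Gam G Z i"
    using vec_star_mono[of _ Y Z] by (force simp: mem_Gam_iff le_fun_def)
qed

text \<open>If there is no edge from \<open>i\<close> to \<open>j\<close>, every nonempty
  \<open>G i u\<close> has \<open>u j = 0\<close> and takes the factor \<open>{0}\<close> from
  \<open>Y j\<close>; an empty \<open>G i u\<close> contributes nothing.\<close>

lemma Gam_cong_dep:
  assumes "\<And>j. (i, j) \<in> dep G \<Longrightarrow> Y j = Z j"
  shows "Gam G Y i = Gam G Z i"
proof -
  have "vec_star u Y = vec_star u Z" if "G i u \<noteq> {}" for u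
  proof -
    have "u l > 0 \<Longrightarrow> Y l = Z l" for l
      using that assms[of l] by (auto simp: dep_def)
    then show ?thesis
      by (intro equalityI vec_star_mono) auto
  qed
  then show ?thesis
    by (fastforce simp: mem_Gam_iff)
qed

lemma vec_star_of_elements:
  assumes "\<And>l. u l > 0 \<Longrightarrow> m l \<in> Y l"
  shows "(\<Sum>l\<in>UNIV. u l * m l) \<in> vec_star u Y"
  unfolding vec_star_iff_lists
  by (rule exI[of _ "\<lambda>l. replicate (u l) (m l)"]) (use assms in \<open>auto simp: sum_list_replicate\<close>)

text \<open>Splits off one copy of \<open>Y j\<close>, so that one summand can vary while the others
  are kept fixed.\<close>

lemma vec_star_pop:
  assumes "u j > 0"
  shows "vec_star u Y = Y j + vec_star (u(j := u j - 1)) Y"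
proof -
  obtain n where n: "u j = Suc n"
    using assms by (auto simp: gr0_conv_Suc)
  have "vec_star u Y = nstar (u j) (Y j) + (\<Sum>l\<in>UNIV - {j}. nstar (u l) (Y l))"
    unfolding vec_star_def by (simp add: sum.remove[of UNIV j])
  moreover have "vec_star (u(j := n)) Y = nstar n (Y j) + (\<Sum>l\<in>UNIV - {j}. nstar (u l) (Y l))"
    unfolding vec_star_def by (simp add: sum.remove[of UNIV j])
  ultimately show ?thesis
    using n by (simp add: add.assoc)
qed

section \<open>Summands are smaller than the total: contraction on initial segments\<close>

lemma sum_list_ge_length: "set xs \<subseteq> {1..} \<Longrightarrow> length xs \<le> sum_list (xs :: nat list)"
  by (induction xs) auto

lemma sum_list_ge_member_plus_length:
  "set xs \<subseteq> {1..} \<Longrightarrow> y \<in> set xs \<Longrightarrow> y + length xs \<le> Suc (sum_list (xs :: nat list))"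
  using sum_list_ge_length by (induction xs) fastforce+

lemma vec_star_lower_bound:
  assumes "Y \<in> SuP" "w \<in> vec_star u Y"
  shows "(\<Sum>l\<in>UNIV. u l) \<le> w"
proof -
  obtain xs where xs: "\<forall>l. length (xs l) = u l \<and> set (xs l) \<subseteq> Y l"
      "w = (\<Sum>l\<in>UNIV. sum_list (xs l))"
    using assms(2) unfolding vec_star_iff_lists by blast
  have "u l \<le> sum_list (xs l)" for l
    using xs(1) assms(1) sum_list_ge_length[of "xs l"] by (fastforce simp: SuP_def)
  then show ?thesis
    using xs(2) by (simp add: sum_mono)
qed

lemma elementary_weight:
  assumes "elementary_system G" "g \<in> G i u" "u l > 0"
  shows "g + (\<Sum>l\<in>UNIV. u l) \<ge> 2"
proof (cases "g = 0")
  case True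
  then show ?thesis using assms by (auto simp: elementary_system_def)
next
  case False
  have "u l \<le> (\<Sum>l\<in>UNIV. u l)"
    by (simp add: member_le_sum)
  then show ?thesis using False assms by linarith
qed

text \<open>All summands are at least 1, so \<open>n\<close> exceeds a summand \<open>y\<close> by
  at least \<open>g\<close> plus the number of other summands. Whenever some summand occurs,
  \<open>g\<close> plus the number of all summands is at least 2, so this excess is
  positive.\<close>

lemma elementary_decomposition:
  assumes "elementary_system G" "Y \<in> SuP" "n \<in> Gam G Y i"
  obtains u g xs where "g \<in> G i u" "\<And>l. length (xs l) = u l" "\<And>l. set (xs l) \<subseteq> Y l"
    "n = g + (\<Sum>l\<in>UNIV. sum_list (xs l))" "\<And>l y. y \<in> set (xs l) \<Longrightarrow> y < n"
proof -
  obtain u g xs where *: "g \<in> G i u" "\<And>l. length (xs l) = u l" "\<And>l. set (xs l) \<subseteq> Y l"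
    "n = g + (\<Sum>l\<in>UNIV. sum_list (xs l))"
    using assms(3) unfolding mem_Gam_iff vec_star_iff_lists by blast
  have pos: "set (xs l) \<subseteq> {1..}" for l
    using *(3)[of l] assms(2) by (auto simp: SuP_def)
  have "y < n" if y: "y \<in> set (xs l)" for l y
  proof -
    have "u l > 0"
      using y *(2)[of l] by (cases "xs l") auto
    then have two: "g + (u l + (\<Sum>h\<in>UNIV - {l}. u h)) \<ge> 2"
      using elementary_weight[OF assms(1) *(1), of l] by (simp add: sum.remove[of UNIV l])
    have "(\<Sum>h\<in>UNIV - {l}. u h) \<le> (\<Sum>h\<in>UNIV - {l}. sum_list (xs h))"
      by (rule sum_mono) (metis *(2) pos sum_list_ge_length)
    moreover have "y + u l \<le> Suc (sum_list (xs l))"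
      using sum_list_ge_member_plus_length[OF pos y] *(2) by simp
    moreover have "n = g + (sum_list (xs l) + (\<Sum>h\<in>UNIV - {l}. sum_list (xs h)))"
      using *(4) by (simp add: sum.remove[of UNIV l])
    ultimately show ?thesis
      using two by linarith
  qed
  with * show ?thesis
    using that by blast
qed

text \<open>Numbers up to \<open>Suc n\<close> are built from strictly smaller summands, hence from
  summands up to \<open>n\<close>.\<close>

lemma Gam_contracting:
  assumes "elementary_system G" "Y \<in> SuP" "\<And>j. Y j \<inter> {..n} \<subseteq> Z j"
  shows "Gam G Y i \<inter> {..Suc n} \<subseteq> Gam G Z i"
proof
  fix x assume x: "x \<in> Gam G Y i \<inter> {..Suc n}"
  then have "x \<in> Gam G Y i" by blast
  from elementary_decomposition[OF assms(1,2) this] obtain u g xs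
    where *: "g \<in> G i u" "\<And>l. length (xs l) = u l" "\<And>l. set (xs l) \<subseteq> Y l"
      "x = g + (\<Sum>l\<in>UNIV. sum_list (xs l))" "\<And>l y. y \<in> set (xs l) \<Longrightarrow> y < x"
    by metis
  have "set (xs l) \<subseteq> Z l" for l
    using *(3)[of l] *(5)[of _ l] x assms(3)[of l] by fastforce
  then show "x \<in> Gam G Z i"
    using * unfolding mem_Gam_iff vec_star_iff_lists by blast
qed

section \<open>Convergence of the iterates; uniqueness and existence of the solution\<close>

lemma Gam_funpow_SuP:
  assumes "elementary_system G" "A \<in> SuP"
  shows "(Gam G ^^ n) A \<in> SuP"
  using assms by (induction n) (auto simp: elementary_system_def basic_system_def)

text \<open>Each application of \<open>Gam G\<close> extends the range of agreement by one. The
  induction starts because tuples in \<open>SuP\<close> agree on \<open>{..0}\<close>: none of their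
  components contains 0.\<close>

lemma Gam_funpow_agree:
  assumes "elementary_system G" "A \<in> SuP" "B \<in> SuP"
  shows "(Gam G ^^ n) A i \<inter> {..n} = (Gam G ^^ n) B i \<inter> {..n}"
proof -
  have "(Gam G ^^ n) A i \<inter> {..n} \<subseteq> (Gam G ^^ n) B i"
    if "A \<in> SuP" for A B i
  proof (induction n arbitrary: i)
    case 0
    then show ?case using that by (force simp: SuP_def)
  next
    case (Suc n)
    then show ?case
      using Gam_contracting[OF assms(1) Gam_funpow_SuP[OF assms(1) that]] by simp
  qed
  then show ?thesis
    using assms(2,3) by blast
qed

lemma solution_funpow: "solution G T \<Longrightarrow> (Gam G ^^ n) T = T"
  by (induction n) (auto simp: solution_def)

lemma Gam_funpow_agree_solution:
  assumes "elementary_system G" "solution G T" "A \<in> SuP" "M \<le> n"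
  shows "(Gam G ^^ n) A i \<inter> {0..M} = T i \<inter> {0..M}"
proof -
  have "(Gam G ^^ n) A i \<inter> {..n} = T i \<inter> {..n}"
    using Gam_funpow_agree[of G A T n i] assms by (simp add: solution_funpow) (simp add: solution_def)
  moreover have "{0..M} = {..n} \<inter> {0..M}"
    using assms(4) by auto
  ultimately show ?thesis
    by blast
qed

lemma solution_unique:
  assumes "elementary_system G" "solution G S" "solution G T"
  shows "S = T"
proof (intro ext set_eqI)
  fix i x
  have "S \<in> SuP"
    using assms(2) by (simp add: solution_def)
  then have "S i \<inter> {0..x} = T i \<inter> {0..x}"
    using Gam_funpow_agree_solution[OF assms(1,3) _ order_refl, of S x i]
    by (simp only: solution_funpow[OF assms(2)])
  moreover have "x \<in> {0..x}"
    by simp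
  ultimately show "x \<in> S i \<longleftrightarrow> x \<in> T i"
    by blast
qed

lemma empty_in_SuP: "(\<lambda>_. {}) \<in> SuP"
  by (simp add: SuP_def)

lemma solution_exists:
  fixes G :: "'k::finite system"
  assumes "elementary_system G"
  shows "\<exists>T. solution G T"
proof -
  define E :: "nat \<Rightarrow> 'k \<Rightarrow> nat set" where "E n = (Gam G ^^ n) (\<lambda>_. {})" for n
  \<comment> \<open>A diagonal limit: membership of \<open>m\<close> no longer changes from the
    \<open>m\<close>th iterate on.\<close>
  define T where "T i = {m. m \<in> E m i}" for i
  have E: "E n \<in> SuP" for n
    unfolding E_def by (intro Gam_funpow_SuP assms empty_in_SuP)
  have stable: "x \<in> E n i \<longleftrightarrow> x \<in> E m i" if "x \<le> m" "m \<le> n" for x n m i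
  proof -
    \<comment> \<open>Viewing the later iterate as \<open>m\<close> steps from another starting
      point allows a comparison with \<open>m\<close> steps from the empty tuple.\<close>
    have "E n = (Gam G ^^ m) (E (n - m))"
      using that by (simp add: E_def flip: funpow_add[THEN fun_cong, simplified])
    then have "E n i \<inter> {..m} = E m i \<inter> {..m}"
      using Gam_funpow_agree[OF assms E empty_in_SuP, of m "n - m" i] by (simp add: E_def)
    then show ?thesis
      using that by auto
  qed
  have TE: "T i \<inter> {..n} = E n i \<inter> {..n}" for i n
    using stable[of _ _ n i] by (auto simp: T_def)
  have T: "T \<in> SuP"
    using E by (force simp: T_def SuP_def)
  have "x \<in> Gam G T i \<longleftrightarrow> x \<in> T i" for x i
  proof -
    have "x \<in> Gam G T i \<longleftrightarrow> x \<in> Gam G (E x) i"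
    proof -
      have "T j \<inter> {..x} \<subseteq> E x j" "E x j \<inter> {..x} \<subseteq> T j" for j
        using TE[of j x] by blast+
      then have "Gam G T i \<inter> {..Suc x} \<subseteq> Gam G (E x) i" "Gam G (E x) i \<inter> {..Suc x} \<subseteq> Gam G T i"
        using Gam_contracting[OF assms T] Gam_contracting[OF assms E] by blast+
      then show ?thesis by auto
    qed
    also have "\<dots> \<longleftrightarrow> x \<in> E (Suc x) i"
      by (simp add: E_def)
    also have "\<dots> \<longleftrightarrow> x \<in> T i"
      using stable[of x x "Suc x" i] by (simp add: T_def)
    finally show ?thesis .
  qed
  then have "T = Gam G T"
    by blast
  then show ?thesis
    using T by (auto simp: solution_def)
qed

section \<open>Emptiness and minima of the components\<close>

lemma min_elem_in: "A \<noteq> {} \<Longrightarrow> min_elem A \<in> A"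
  unfolding min_elem_def by (metis LeastI equals0I)

lemma min_elem_le: "a \<in> A \<Longrightarrow> min_elem A \<le> a"
  unfolding min_elem_def by (rule Least_le)

locale elementary_solution =
  fixes G :: "'k::finite system" and T :: "'k \<Rightarrow> nat set"
  assumes elementary: "elementary_system G" and solution: "solution G T"
begin

abbreviation m :: "'k \<Rightarrow> nat" where "m i \<equiv> min_elem (T i)"

lemma T_SuP: "T \<in> SuP"
  using solution by (simp add: solution_def)

lemma T_fixed: "Gam G T = T"
  using solution by (simp add: solution_def)

lemma T_decomposition:
  assumes "n \<in> T i"
  obtains u g xs where "g \<in> G i u" "\<And>l. length (xs l) = u l" "\<And>l. set (xs l) \<subseteq> T l"
    "n = g + (\<Sum>l\<in>UNIV. sum_list (xs l))" "\<And>l y. y \<in> set (xs l) \<Longrightarrow> y < n"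
proof -
  have "n \<in> Gam G T i" using assms T_fixed by simp
  from elementary_decomposition[OF elementary T_SuP this] show ?thesis
    using that by metis
qed

text \<open>Replacing every summand of \<open>m i\<close> by the minimum of its component cannot
  increase the total and yields another element of \<open>T i\<close>. By minimality of
  \<open>m i\<close> the total is unchanged.\<close>

lemma min_decomposition:
  assumes "T i \<noteq> {}"
  obtains u g where "g \<in> G i u" "m i = g + (\<Sum>l\<in>UNIV. u l * m l)"
    "\<And>l. u l > 0 \<Longrightarrow> T l \<noteq> {} \<and> m l < m i"
proof -
  obtain u g xs where *: "g \<in> G i u" "\<And>l. length (xs l) = u l" "\<And>l. set (xs l) \<subseteq> T l"
    "m i = g + (\<Sum>l\<in>UNIV. sum_list (xs l))" "\<And>l y. y \<in> set (xs l) \<Longrightarrow> y < m i"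
    using T_decomposition[OF min_elem_in[OF assms]] by metis
  have le: "u l * m l \<le> sum_list (xs l)" for l
  proof -
    have "length ys * m l \<le> sum_list ys" if "set ys \<subseteq> T l" for ys
      using that by (induction ys) (auto intro!: add_mono min_elem_le)
    then show ?thesis using *(2,3) by metis
  qed
  have lt: "T l \<noteq> {} \<and> m l < m i" if u: "u l > 0" for l
  proof -
    obtain y where "y \<in> set (xs l)"
      using u *(2)[of l] by (cases "xs l") auto
    then show ?thesis
      using *(3,5) min_elem_le by (metis empty_iff le_less_trans subsetD)
  qed
  have "(\<Sum>l\<in>UNIV. u l * m l) \<in> vec_star u T"
    using lt min_elem_in by (intro vec_star_of_elements) blast
  then have "m i \<le> g + (\<Sum>l\<in>UNIV. u l * m l)"
    using mem_GamI[of g G i u _ T] *(1) T_fixed by (intro min_elem_le) auto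
  moreover have "(\<Sum>l\<in>UNIV. u l * m l) \<le> (\<Sum>l\<in>UNIV. sum_list (xs l))"
    using le by (rule sum_mono)
  ultimately show ?thesis
    using that[OF *(1)] *(4) lt by simp
qed

text \<open>The empty tuple lies below \<open>T\<close>; monotone iteration preserves this and
  leaves \<open>T\<close> fixed.\<close>

lemma funpow_empty_subset: "(Gam G ^^ n) (\<lambda>_. {}) i \<subseteq> T i"
proof -
  have "(Gam G ^^ n) (\<lambda>_. {}) \<le> (Gam G ^^ n) T"
    by (intro funpow_mono Gam_mono) (simp add: le_fun_def)
  then show ?thesis
    by (simp add: solution_funpow[OF solution] le_fun_def)
qed

lemma funpow_empty_mono: "n \<le> n' \<Longrightarrow> (Gam G ^^ n) (\<lambda>_. {}) i \<subseteq> (Gam G ^^ n') (\<lambda>_. {}) i"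
  using funpow_decreasing[OF _ Gam_mono, of n n' G] by (simp add: bot_fun_def le_fun_def)

text \<open>
  A minimum only uses strictly smaller minima, so it is reached after as many steps as there are
  components whose minimum does not exceed it.
\<close>

lemma min_in_funpow_empty:
  assumes "T i \<noteq> {}"
  shows "m i \<in> (Gam G ^^ card {j. m j \<le> m i}) (\<lambda>_. {}) i"
  using assms
proof (induction "m i" arbitrary: i rule: less_induct)
  case less
  from min_decomposition[OF less.prems] obtain u g where
    *: "g \<in> G i u" "m i = g + (\<Sum>l\<in>UNIV. u l * m l)" "\<And>l. u l > 0 \<Longrightarrow> T l \<noteq> {} \<and> m l < m i"
    by metis
  define r where "r = card {j. m j < m i}"
  have "m l \<in> (Gam G ^^ r) (\<lambda>_. {}) l" if "u l > 0" for l
  proof -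
    have "card {j. m j \<le> m l} \<le> r"
      unfolding r_def using *(3)[OF that] by (intro card_mono) auto
    then show ?thesis
      using less.hyps[of l] *(3)[OF that] funpow_empty_mono by blast
  qed
  then have "m i \<in> (Gam G ^^ Suc r) (\<lambda>_. {}) i"
    using mem_GamI[of g G i u _ "(Gam G ^^ r) (\<lambda>_. {})"] *(1,2) vec_star_of_elements[of u m] by simp
  moreover have "Suc r \<le> card {j. m j \<le> m i}"
    unfolding r_def Suc_le_eq by (intro psubset_card_mono) auto
  ultimately show ?case
    using funpow_empty_mono by blast
qed

lemma min_in_funpow_CARD:
  assumes "T i \<noteq> {}"
  shows "m i \<in> (Gam G ^^ CARD('k)) (\<lambda>_. {}) i"
  using min_in_funpow_empty[OF assms] funpow_empty_mono[of "card {j. m j \<le> m i}" "CARD('k)" i]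
  by (auto simp: card_mono)

lemma empty_iff_funpow_empty: "T i = {} \<longleftrightarrow> (Gam G ^^ CARD('k)) (\<lambda>_. {}) i = {}"
  using min_in_funpow_CARD funpow_empty_subset by blast

lemma min_elem_funpow:
  assumes "T i \<noteq> {}"
  shows "m i = min_elem ((Gam G ^^ CARD('k)) (\<lambda>_. {}) i)"
proof (rule antisym)
  have "(Gam G ^^ CARD('k)) (\<lambda>_. {}) i \<noteq> {}"
    using assms empty_iff_funpow_empty by blast
  then show "m i \<le> min_elem ((Gam G ^^ CARD('k)) (\<lambda>_. {}) i)"
    using min_elem_in funpow_empty_subset min_elem_le by (metis subsetD)
  show "min_elem ((Gam G ^^ CARD('k)) (\<lambda>_. {}) i) \<le> m i"
    using min_in_funpow_CARD[OF assms] by (rule min_elem_le)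
qed

end

section \<open>Additively closed sets and arithmetical progressions\<close>

text \<open>
  With \<open>d\<close> the least positive difference \<open>a - b\<close> of elements of \<open>S\<close>, all elements are
  multiples of \<open>d\<close>; writing \<open>b = d * k\<close>, a number \<open>d * n\<close> with \<open>n = q * k + r\<close> and \<open>r < k \<le> q\<close>
  is \<open>(q - r) * b + r * a\<close>.
\<close>

lemma additive_closed_eventually_multiples:
  fixes S :: "nat set"
  assumes pos: "s \<in> S" "s > 0" and add: "\<And>a b. a \<in> S \<Longrightarrow> b \<in> S \<Longrightarrow> a + b \<in> S"
  obtains d N where "d > 0" "\<And>a. a \<in> S \<Longrightarrow> d dvd a" "\<And>n. n \<ge> N \<Longrightarrow> d * n \<in> S"
proof -
  define D where "D = {d. d > 0 \<and> (\<exists>a\<in>S. \<exists>b\<in>S. a = b + d)}"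
  have "s \<in> D"
    using pos add[OF pos(1) pos(1)] by (auto simp: D_def)
  define d where "d = (LEAST d. d \<in> D)"
  have "d \<in> D"
    unfolding d_def using \<open>s \<in> D\<close> by (rule LeastI)
  then obtain a b where d: "d > 0" "a \<in> S" "b \<in> S" "a = b + d"
    by (auto simp: D_def)
  have min: "d \<le> e" if "e \<in> D" for e
    unfolding d_def using that by (rule Least_le)
  have mult: "Suc n * x \<in> S" if "x \<in> S" for n x
    using that by (induction n) (auto intro: add)
  have mult0: "y + n * x \<in> S" if "x \<in> S" "y \<in> S" for n x y
    using that mult[of x] add by (cases n) auto
  have dvd: "d dvd x" if x: "x \<in> S" for x
  proof (rule ccontr)
    assume "\<not> d dvd x"
    then have r: "0 < x mod d" by (simp add: dvd_eq_mod_eq_0)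
    \<comment> \<open>Substituting \<open>d = a - b\<close> into the division of \<open>x\<close> by
      \<open>d\<close> shows that the remainder is a difference of two elements of \<open>S\<close>,
      which contradicts the minimality of \<open>d\<close>.\<close>
    have "x + (x + (x div d) * b) = (x + (x div d) * a) + x mod d"
      using d(4) div_mult_mod_eq[of x d] by (simp add: algebra_simps)
    moreover have "x + (x + (x div d) * b) \<in> S" "x + (x div d) * a \<in> S"
      using mult0 add x d by auto
    ultimately have "x mod d \<in> D"
      using r unfolding D_def by blast
    then show False
      using min[of "x mod d"] mod_less_divisor[OF d(1), of x] by linarith
  qed
  obtain k where k: "b = d * k"
    using dvd[OF d(3)] by blast
  show ?thesis
  \<comment> \<open>The threshold gives \<open>n div k > k > n mod k\<close> if
    \<open>k > 0\<close>, and \<open>n > 0\<close> if \<open>k = 0\<close>, where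
    \<open>b = 0\<close> and \<open>a = d\<close>.\<close>
  proof (rule that[of d "Suc k * Suc k"])
    fix n assume n: "Suc k * Suc k \<le> n"
    show "d * n \<in> S"
    proof (cases "k = 0")
      case True
      then have "a = d" using k d by simp
      then show ?thesis
        using mult[OF d(2), of "n - 1"] n by (simp add: mult.commute flip: mult_Suc_right)
    next
      case False
      define q r where "q = n div k" and "r = n mod k"
      have n_eq: "n = q * k + r" by (simp add: q_def r_def)
      have "r < k" using False by (simp add: r_def)
      moreover have "k < q"
      proof -
        have "Suc k * k \<le> n"
          using n by simp
        then have "Suc k \<le> q"
          unfolding q_def using False by (simp add: less_eq_div_iff_mult_less_eq)
        then show ?thesis by simp
      qed
      ultimately obtain p where p: "q = Suc p + r"
        by (metis add.commute add_Suc_right less_imp_Suc_add less_trans)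
      have "d * n = Suc p * b + r * a"
        unfolding n_eq p d(4) k by (simp add: algebra_simps)
      then show ?thesis
        using mult0[OF d(2) mult[OF d(3)]] by simp
    qed
  qed (use d dvd in auto)
qed

text \<open>Since \<open>(c + a) + (c + b) = c + (c + a + b)\<close>, the translate of
  \<open>A\<close> by \<open>c\<close> is additively closed, hence eventually consists of all
  multiples of some \<open>d\<close>. Translating back gives the progression.\<close>

lemma finite_Un_arith_progression:
  assumes "A \<noteq> {}" "A \<subseteq> {1..}" and add: "\<And>a b. a \<in> A \<Longrightarrow> b \<in> A \<Longrightarrow> c + a + b \<in> A"
  shows "\<exists>F S. finite F \<and> arith_progression S \<and> A = F \<union> S"
proof -
  obtain a where a: "a \<in> A" "a > 0"
    using assms(1,2) by force
  have "c + a \<in> (+) c ` A" "c + a > 0"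
    using a by auto
  moreover have "x + y \<in> (+) c ` A" if xy: "x \<in> (+) c ` A" "y \<in> (+) c ` A" for x y
  proof -
    obtain a b where "a \<in> A" "b \<in> A" "x = c + a" "y = c + b"
      using xy by blast
    then show ?thesis
      using add[of a b] by (intro image_eqI[of _ _ "c + a + b"]) (auto simp: add_ac)
  qed
  ultimately obtain d N where d: "d > 0" "\<And>x. x \<in> (+) c ` A \<Longrightarrow> d dvd x"
      "\<And>n. n \<ge> N \<Longrightarrow> d * n \<in> (+) c ` A"
    using additive_closed_eventually_multiples[of "c + a" "(+) c ` A"] by metis
  \<comment> \<open>\<open>K\<close> is at least \<open>N\<close>, and \<open>d * K\<close> is at
    least \<open>c\<close>, so the subtraction in \<open>d * K - c\<close> is not truncated.\<close>
  define K where "K = N + c"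
  have "d * K \<ge> c"
    using d(1) by (cases d) (simp_all add: K_def)
  define S where "S = {(d * K - c) + d * n | n. True}"
  have "S \<subseteq> A"
  proof
    fix x assume "x \<in> S"
    then obtain n where "x = (d * K - c) + d * n" by (auto simp: S_def)
    then have "c + x = d * (K + n)"
      using \<open>d * K \<ge> c\<close> by (simp add: algebra_simps)
    moreover have "d * (K + n) \<in> (+) c ` A"
      by (rule d(3)) (simp add: K_def)
    ultimately show "x \<in> A" by auto
  qed
  moreover have "x \<in> S" if x: "x \<in> A" "x \<ge> d * K" for x
  proof -
    obtain n where n: "c + x = d * n"
      using d(2)[of "c + x"] x by blast
    then have "d * K \<le> d * n" using x by linarith
    then have "K \<le> n" using d(1) by simp
    then obtain n' where "n = K + n'" using le_Suc_ex by blast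
    then have "x = (d * K - c) + d * n'"
      using n \<open>d * K \<ge> c\<close> by (simp add: algebra_simps)
    then show ?thesis by (auto simp: S_def)
  qed
  ultimately have "A = (A \<inter> {..<d * K}) \<union> S"
    by force
  moreover have "arith_progression S"
    using d(1) by (auto simp: arith_progression_def S_def Suc_le_eq)
  ultimately show ?thesis
    by (intro exI[of _ "A \<inter> {..<d * K}"] exI[of _ S]) simp
qed

section \<open>Gap gcds through integer divisibility\<close>

text \<open>Moving to integers allows differences to be added and subtracted freely. The truncated
  differences in \<open>gap_gcd\<close> are genuine ones because the minimum is subtracted.\<close>

lemma gap_gcd_dvd_iff:
  "z dvd int (gap_gcd A) \<longleftrightarrow> (\<forall>a\<in>A. z dvd int a - int (min_elem A))"
proof -
  have "z dvd int (gap_gcd A) \<longleftrightarrow> nat \<bar>z\<bar> dvd gap_gcd A"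
    by (simp add: int_dvd_int_iff[symmetric])
  also have "\<dots> \<longleftrightarrow> (\<forall>a\<in>A. nat \<bar>z\<bar> dvd a - min_elem A)"
    by (simp add: gap_gcd_def dvd_Gcd_iff)
  also have "\<dots> \<longleftrightarrow> (\<forall>a\<in>A. z dvd int a - int (min_elem A))"
    by (intro ball_cong refl)
      (simp add: min_elem_le int_dvd_int_iff[symmetric] flip: of_nat_diff)
  finally show ?thesis .
qed

lemma int_gap_gcd_dvd_diff: "a \<in> A \<Longrightarrow> int (gap_gcd A) dvd int a - int (min_elem A)"
  using gap_gcd_dvd_iff[of "int (gap_gcd A)" A] by simp

section \<open>Reduced systems: translations along edges, periods and progressions\<close>

locale reduced_solution = elementary_solution +
  assumes T_nonempty: "T i \<noteq> {}"
begin

lemma vec_star_T_nonempty: "vec_star u T \<noteq> {}"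
  using vec_star_of_elements[of u m T] min_elem_in[OF T_nonempty] by blast

text \<open>Fix \<open>g\<close> and the sum \<open>w\<close> of all summands but one from
  \<open>T j\<close>, and take \<open>c = g + w\<close>. There are at least
  \<open>(\<Sum>l\<in>UNIV. u l) - 1\<close> fixed summands, each positive, so the elementary
  condition gives \<open>c > 0\<close>.\<close>

lemma dep_shift:
  assumes "(i, j) \<in> dep G"
  shows "\<exists>c>0. \<forall>t\<in>T j. c + t \<in> T i"
proof -
  obtain u g where u: "g \<in> G i u" "u j > 0"
    using assms by (auto simp: dep_def)
  define v where "v = u(j := u j - 1)"
  obtain w where w: "w \<in> vec_star v T"
    using vec_star_T_nonempty by blast
  have "(\<Sum>l\<in>UNIV. u l) = Suc (\<Sum>l\<in>UNIV. v l)"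
    using u(2) by (simp add: v_def sum.remove[of UNIV j])
  then have "g + w > 0"
    using elementary_weight[OF elementary u] vec_star_lower_bound[OF T_SuP w] by linarith
  moreover have "(g + w) + t \<in> T i" if "t \<in> T j" for t
  proof -
    have "t + w \<in> vec_star u T"
      using vec_star_pop[of u j T] u(2) that w by (auto simp: v_def)
    then show ?thesis
      using mem_GamI[of g G i u "t + w" T] u(1) T_fixed by (simp add: algebra_simps)
  qed
  ultimately show ?thesis by blast
qed

lemma dep_trancl_shift:
  assumes "(i, j) \<in> (dep G)\<^sup>+"
  shows "\<exists>c>0. \<forall>t\<in>T j. c + t \<in> T i"
  using assms
proof (induction rule: trancl_induct)
  case (base j)
  then show ?case by (rule dep_shift)
next
  case (step j l)
  obtain c d where "c > 0" "\<forall>t\<in>T j. c + t \<in> T i" "\<forall>t\<in>T l. d + t \<in> T j"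
    using step dep_shift by blast
  then show ?case
    by (intro exI[of _ "c + d"]) (auto simp: add.assoc)
qed

lemma periodic_if_strong_class:
  assumes "strong_class G i \<noteq> {}"
  shows "periodic (T i)"
proof -
  have "(i, i) \<in> (dep G)\<^sup>+"
    using assms by (auto simp: strong_class_def)
  then show ?thesis
    unfolding periodic_def by (rule dep_trancl_shift)
qed

text \<open>Two summands of equation \<open>j\<close> lie in the class of \<open>i\<close>.
  Translating \<open>T i\<close> into their components, combining there and translating
  \<open>T j\<close> back into \<open>T i\<close> gives closure under \<open>s + t\<close> plus a
  constant.\<close>

lemma arith_progression_if_branching:
  assumes "j \<in> strong_class G i" "G j u \<noteq> {}" "(\<Sum>l\<in>strong_class G i. u l) \<ge> 2"
  shows "\<exists>F S. finite F \<and> arith_progression S \<and> T i = F \<union> S"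
proof -
  let ?C = "strong_class G i"
  have "\<exists>a\<in>?C. u a > 0"
  proof (rule ccontr)
    assume "\<not> ?thesis"
    then have "(\<Sum>l\<in>?C. u l) = 0" by simp
    then show False using assms(3) by simp
  qed
  then obtain a where a: "a \<in> ?C" "u a > 0" by blast
  \<comment> \<open>One occurrence of \<open>a\<close> is removed before \<open>b\<close> is chosen,
    so \<open>b = a\<close> is possible when \<open>a\<close> occurs twice.\<close>
  define v where "v = u(a := u a - 1)"
  have "(\<Sum>l\<in>?C. u l) = Suc (\<Sum>l\<in>?C. v l)"
    using a by (simp add: v_def sum.remove[of ?C a])
  then have "(\<Sum>l\<in>?C. v l) \<noteq> 0"
    using assms(3) by linarith
  then obtain b where b: "b \<in> ?C" "v b > 0"
    by (metis gr0I sum.neutral)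
  obtain w where w: "w \<in> vec_star (v(b := v b - 1)) T"
    using vec_star_T_nonempty by blast
  obtain g where g: "g \<in> G j u"
    using assms(2) by blast
  have branch: "g + (s + (t + w)) \<in> T j" if "s \<in> T a" "t \<in> T b" for s t
  proof -
    have "s + (t + w) \<in> vec_star u T"
      unfolding vec_star_pop[of u a T, OF a(2)] v_def[symmetric] vec_star_pop[of v b T, OF b(2)]
      using that w by (intro set_plus_intro)
    then show ?thesis
      using mem_GamI[of g G j u _ T] g T_fixed by simp
  qed
  have "(a, i) \<in> (dep G)\<^sup>+" "(b, i) \<in> (dep G)\<^sup>+" "(i, j) \<in> (dep G)\<^sup>+"
    using a(1) b(1) assms(1) by (auto simp: strong_class_def)
  from this[THEN dep_trancl_shift] obtain ca cb cj
    where c: "\<forall>t\<in>T i. ca + t \<in> T a" "\<forall>t\<in>T i. cb + t \<in> T b" "\<forall>t\<in>T j. cj + t \<in> T i"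
    by blast
  have "(cj + g + ca + cb + w) + s + t \<in> T i" if "s \<in> T i" "t \<in> T i" for s t
  proof -
    have "cj + (g + ((ca + s) + ((cb + t) + w))) \<in> T i"
      using that c branch by blast
    then show ?thesis by (simp add: algebra_simps)
  qed
  moreover have "T i \<subseteq> {1..}"
    using T_SuP by (simp add: SuP_def)
  ultimately show ?thesis
    using finite_Un_arith_progression[OF T_nonempty] by blast
qed

section \<open>Divisibility along edges and the gcd formula\<close>

text \<open>A translate of \<open>T j\<close> lies in \<open>T i\<close>, so differences within
  \<open>T j\<close> are differences within \<open>T i\<close>.\<close>

lemma gap_gcd_dvd_dep:
  assumes "(i, j) \<in> dep G"
  shows "gap_gcd (T i) dvd gap_gcd (T j)"
proof -
  let ?q = "int (gap_gcd (T i))"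
  obtain c where c: "\<forall>t\<in>T j. c + t \<in> T i"
    using dep_shift[OF assms] by blast
  have "?q dvd int t - int (m j)" if "t \<in> T j" for t
  proof -
    have "?q dvd (int (c + t) - int (m i)) - (int (c + m j) - int (m i))"
      using c that min_elem_in[OF T_nonempty] by (intro dvd_diff int_gap_gcd_dvd_diff) auto
    then show ?thesis by simp
  qed
  then have "?q dvd int (gap_gcd (T j))"
    by (simp add: gap_gcd_dvd_iff)
  then show ?thesis by simp
qed

lemma gap_gcd_dvd_dep_rtrancl: "(i, j) \<in> (dep G)\<^sup>* \<Longrightarrow> gap_gcd (T i) dvd gap_gcd (T j)"
  by (induction rule: rtrancl_induct) (auto intro: dvd_trans gap_gcd_dvd_dep)

abbreviation offset :: "'a \<Rightarrow> ('a \<Rightarrow> nat) \<Rightarrow> nat \<Rightarrow> int" where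
  "offset j u g \<equiv> int g + (\<Sum>l\<in>UNIV. int (u l) * int (m l)) - int (m j)"

text \<open>Decompose \<open>t\<close>: then \<open>t - m j\<close> is an offset plus the
  differences \<open>y - m l\<close> over the summands \<open>y\<close> of \<open>t\<close>. These
  are smaller than \<open>t\<close> and belong to components still reachable from \<open>i\<close>,
  so strong induction on \<open>t\<close> applies.\<close>

lemma dvd_diff_min_if_dvd_offsets:
  assumes z: "\<And>j u g. (i, j) \<in> (dep G)\<^sup>* \<Longrightarrow> g \<in> G j u \<Longrightarrow> z dvd offset j u g"
    and "(i, j) \<in> (dep G)\<^sup>*" "t \<in> T j"
  shows "z dvd int t - int (m j)"
  using assms(2,3)
proof (induction t arbitrary: j rule: less_induct)
  case (less t)
  obtain u g xs where *: "g \<in> G j u" "\<And>l. length (xs l) = u l" "\<And>l. set (xs l) \<subseteq> T l"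
    "t = g + (\<Sum>l\<in>UNIV. sum_list (xs l))" "\<And>l y. y \<in> set (xs l) \<Longrightarrow> y < t"
    using T_decomposition[OF less.prems(2)] by metis
  have part: "z dvd int (sum_list (xs l)) - int (u l) * int (m l)" for l
  proof -
    have "z dvd int y - int (m l)" if "y \<in> set (xs l)" for y
    proof -
      have "u l > 0"
        using that *(2)[of l] by (cases "xs l") auto
      then have "(i, l) \<in> (dep G)\<^sup>*"
        using *(1) by (intro rtrancl_into_rtrancl[OF less.prems(1)]) (auto simp: dep_def)
      then show ?thesis
        using less.IH[of y l] that *(3,5) by blast
    qed
    \<comment> \<open>Stated for an arbitrary list so that induction over it is possible.\<close>
    then have "\<forall>y\<in>set ys. z dvd int y - int (m l) \<Longrightarrow>
        z dvd int (sum_list ys) - int (length ys) * int (m l)" for ys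
    proof (induction ys)
      case (Cons y ys)
      have "int (sum_list (y # ys)) - int (length (y # ys)) * int (m l) =
          (int y - int (m l)) + (int (sum_list ys) - int (length ys) * int (m l))"
        by (simp add: algebra_simps)
      then show ?case using Cons by (metis dvd_add list.set_intros)
    qed simp
    then show ?thesis
      using \<open>\<And>y. y \<in> set (xs l) \<Longrightarrow> z dvd int y - int (m l)\<close> *(2)[of l] by metis
  qed
  have "int t - int (m j) =
      offset j u g + (\<Sum>l\<in>UNIV. int (sum_list (xs l)) - int (u l) * int (m l))"
    unfolding *(4) by (simp add: sum_subtractf)
  moreover have "z dvd (\<Sum>l\<in>UNIV. int (sum_list (xs l)) - int (u l) * int (m l))"
    by (intro dvd_sum part)
  ultimately show ?case
    using z[OF less.prems(1) *(1)] by (simp only: dvd_add)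
qed

text \<open>Both sides are nonnegative and divide each other. In one direction, substituting minima
  into equation \<open>j\<close> produces an element of \<open>T j\<close>, so each offset is a
  difference from \<open>m j\<close>, divisible by \<open>gap_gcd (T j)\<close> and hence by
  \<open>gap_gcd (T i)\<close>.\<close>

lemma gap_gcd_eq:
  "int (gap_gcd (T i)) = Gcd (\<Union>j\<in>{j. (i, j) \<in> (dep G)\<^sup>*}. \<Union>u. offset j u ` G j u)"
  (is "_ = Gcd ?X")
proof (rule zdvd_antisym_nonneg)
  show "Gcd ?X dvd int (gap_gcd (T i))"
    unfolding gap_gcd_dvd_iff
    by (intro ballI dvd_diff_min_if_dvd_offsets[of i]) (auto intro!: Gcd_dvd)
  show "int (gap_gcd (T i)) dvd Gcd ?X"
  proof (rule Gcd_greatest)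
    fix x assume "x \<in> ?X"
    then obtain j u g where j: "(i, j) \<in> (dep G)\<^sup>*" "g \<in> G j u" "x = offset j u g"
      by blast
    have "g + (\<Sum>l\<in>UNIV. u l * m l) \<in> T j"
      using mem_GamI[of g G j u _ T] j(2) T_fixed min_elem_in[OF T_nonempty]
        vec_star_of_elements[of u m T] by auto
    then have "int (gap_gcd (T j)) dvd x"
      using int_gap_gcd_dvd_diff j(3) by fastforce
    then show "int (gap_gcd (T i)) dvd x"
      using gap_gcd_dvd_dep_rtrancl[OF j(1)] by (meson dvd_trans int_dvd_int_iff)
  qed
qed auto

end

section \<open>Closure properties of periodic and eventually periodic sets\<close>

lemma periodic_plus: "periodic A \<Longrightarrow> periodic (A + B)"
  unfolding periodic_def by (metis add.assoc set_plus_elim set_plus_intro)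

lemma periodic_mult:
  assumes "\<forall>a\<in>A. p + a \<in> A" "a \<in> A"
  shows "n * p + a \<in> (A :: nat set)"
  using assms by (induction n) (auto simp: add.assoc)

lemma periodic_Un:
  assumes "periodic A" "periodic B"
  shows "periodic (A \<union> B)"
proof -
  obtain p q where "p > 0" "\<forall>a\<in>A. p + a \<in> A" "q > 0" "\<forall>b\<in>B. q + b \<in> B"
    using assms by (auto simp: periodic_def)
  then show ?thesis
    unfolding periodic_def using periodic_mult[of A p _ q] periodic_mult[of B q _ p]
    by (intro exI[of _ "p * q"]) (auto simp: mult.commute)
qed

text \<open>A normal form that reduces the closure properties below to finite sets and periodic
  sets.\<close>

lemma eventually_periodic_iff:
  "eventually_periodic A \<longleftrightarrow> (\<exists>F R. finite F \<and> periodic R \<and> A = F \<union> R)"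
proof
  assume "eventually_periodic A"
  then obtain p m where p: "p > 0" "\<forall>a\<in>A. a \<ge> m \<longrightarrow> a + p \<in> A"
    by (auto simp: eventually_periodic_def)
  have "periodic (A \<inter> {m..})"
    unfolding periodic_def using p by (intro exI[of _ p]) (auto simp: add.commute)
  moreover have "A = (A \<inter> {..<m}) \<union> (A \<inter> {m..})"
    by auto
  ultimately show "\<exists>F R. finite F \<and> periodic R \<and> A = F \<union> R"
    by (intro exI[of _ "A \<inter> {..<m}"] exI[of _ "A \<inter> {m..}"]) simp
next
  assume "\<exists>F R. finite F \<and> periodic R \<and> A = F \<union> R"
  then obtain F R p where F: "finite F" "A = F \<union> R" and p: "p > 0" "\<forall>a\<in>R. p + a \<in> R"
    by (auto simp: periodic_def)
  obtain m where "\<forall>a\<in>F. a < m"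
    using F(1) by (auto simp: finite_nat_set_iff_bounded)
  then show "eventually_periodic A"
    unfolding eventually_periodic_def using F p
    by (intro exI[of _ p] conjI exI[of _ m]) (auto simp: add.commute)
qed

lemma eventually_periodic_finite: "finite A \<Longrightarrow> eventually_periodic A"
  unfolding eventually_periodic_iff by (intro exI[of _ A] exI[of _ "{}"]) (auto simp: periodic_def)

lemma eventually_periodic_periodic: "periodic A \<Longrightarrow> eventually_periodic A"
  unfolding eventually_periodic_iff by (intro exI[of _ "{}"] exI[of _ A]) auto

lemma eventually_periodic_Un:
  assumes "eventually_periodic A" "eventually_periodic B"
  shows "eventually_periodic (A \<union> B)"
proof -
  obtain F R F' R' where "finite F" "periodic R" "A = F \<union> R" "finite F'" "periodic R'" "B = F' \<union> R'"
    using assms unfolding eventually_periodic_iff by blast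
  then show ?thesis
    unfolding eventually_periodic_iff using periodic_Un
    by (intro exI[of _ "F \<union> F'"] exI[of _ "R \<union> R'"]) auto
qed

lemma eventually_periodic_UN:
  "finite I \<Longrightarrow> (\<And>i. i \<in> I \<Longrightarrow> eventually_periodic (A i)) \<Longrightarrow> eventually_periodic (\<Union>i\<in>I. A i)"
  by (induction rule: finite_induct)
    (auto intro: eventually_periodic_Un eventually_periodic_finite)

lemma eventually_periodic_plus:
  assumes "eventually_periodic A" "eventually_periodic B"
  shows "eventually_periodic (A + B)"
proof -
  obtain F R F' R' where *: "finite F" "periodic R" "A = F \<union> R" "finite F'" "periodic R'" "B = F' \<union> R'"
    using assms unfolding eventually_periodic_iff by blast
  \<comment> \<open>Every sum outside the finite part \<open>F + F'\<close> has a summand in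
    \<open>R\<close> or \<open>R'\<close>, and that summand can be shifted.\<close>
  have "A + B = (F + F') \<union> ((R + B) \<union> (R' + A))"
    unfolding * add.commute[of R'] by (auto elim!: set_plus_elim)
  moreover have "periodic ((R + B) \<union> (R' + A))"
    using * by (intro periodic_Un periodic_plus)
  moreover have "finite (F + F')"
    using * by (simp add: finite_set_plus)
  ultimately show ?thesis
    unfolding eventually_periodic_iff by blast
qed

lemma eventually_periodic_sum:
  "finite I \<Longrightarrow> (\<And>i. i \<in> I \<Longrightarrow> eventually_periodic (A i)) \<Longrightarrow> eventually_periodic (\<Sum>i\<in>I. A i)"
  by (induction rule: finite_induct)
    (auto intro: eventually_periodic_plus eventually_periodic_finite simp: set_zero)

lemma eventually_periodic_nstar: "eventually_periodic A \<Longrightarrow> eventually_periodic (nstar n A)"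
  by (induction n) (auto intro: eventually_periodic_plus eventually_periodic_finite)

lemma nstar_add: "nstar (p + q) B = nstar p B + nstar q B"
proof (induction p)
  case 0
  then show ?case by (metis add_0 nstar.simps(1) set_zero)
qed (simp add: add.assoc)

lemma mult_mem_nstar: "b \<in> B \<Longrightarrow> n * b \<in> nstar n B"
  by (induction n) auto

lemma nstar_subset_zero: "B \<subseteq> {0} \<Longrightarrow> nstar n B \<subseteq> {0}"
  by (induction n) (auto elim!: set_plus_elim)

text \<open>If \<open>p\<close> is a period of the periodic part of \<open>Q\<close> and
  \<open>b\<close> is a positive element of \<open>B\<close>, adding \<open>p\<close> further copies
  of \<open>b\<close> shifts a sum by \<open>p * b\<close>. Without a positive \<open>b\<close> the
  set is contained in \<open>{0}\<close>. The finite part of \<open>Q\<close> contributes finitely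
  many sets \<open>nstar q B\<close>.\<close>

lemma eventually_periodic_set_star:
  assumes "eventually_periodic Q" "eventually_periodic B"
  shows "eventually_periodic (set_star Q B)"
proof (cases "B \<subseteq> {0}")
  case True
  have "set_star Q B \<subseteq> {0}"
    unfolding set_star_def using nstar_subset_zero[OF True] by (rule UN_least)
  then show ?thesis
    by (intro eventually_periodic_finite) (simp add: finite_subset)
next
  case False
  then obtain b where b: "b \<in> B" "b > 0" by auto
  obtain F R p where Q: "finite F" "Q = F \<union> R" "p > 0" "\<forall>a\<in>R. p + a \<in> R"
    using assms(1) unfolding eventually_periodic_iff periodic_def by blast
  have "p * b + x \<in> set_star R B" if x: "x \<in> set_star R B" for x
  proof -
    obtain q where "q \<in> R" "x \<in> nstar q B"
      using x by (auto simp: set_star_def)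
    then have "p + q \<in> R" "p * b + x \<in> nstar (p + q) B"
      using Q(4) mult_mem_nstar[OF b(1), of p] by (auto simp: nstar_add)
    then show ?thesis
      unfolding set_star_def by blast
  qed
  then have "periodic (set_star R B)"
    unfolding periodic_def using Q(3) b(2) by (intro exI[of _ "p * b"]) simp
  moreover have "set_star Q B = (\<Union>q\<in>F. nstar q B) \<union> set_star R B"
    unfolding set_star_def Q(2) by blast
  ultimately show ?thesis
    using Q(1) assms(2) by (simp add: eventually_periodic_Un eventually_periodic_UN
        eventually_periodic_nstar eventually_periodic_periodic)
qed

text \<open>
  The hypothesis says nothing about components \<open>Y j\<close> with \<open>(i, j) \<notin> dep G\<close>, even though they may
  occur in the right-hand side; since \<open>Gam G Y i\<close> does not depend on them, they can be replaced by
  the empty set.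
\<close>

lemma eventually_periodic_Gam:
  assumes Gam: "\<And>Y. Gam G Y i = R + (\<Union>Q\<in>QQ. \<Sum>j\<in>UNIV. set_star (Q j) (Y j))"
    and "eventually_periodic R" "finite QQ" "\<And>Q j. Q \<in> QQ \<Longrightarrow> eventually_periodic (Q j)"
    and "\<And>j. (i, j) \<in> dep G \<Longrightarrow> eventually_periodic (Y j)"
  shows "eventually_periodic (Gam G Y i)"
proof -
  define Z where "Z j = (if (i, j) \<in> dep G then Y j else {})" for j
  have Z: "eventually_periodic (Z j)" for j
    using assms(5) by (simp add: Z_def eventually_periodic_finite)
  have "Gam G Y i = Gam G Z i"
    by (rule Gam_cong_dep) (simp add: Z_def)
  moreover have "eventually_periodic (Gam G Z i)"
    unfolding Gam using assms(2-4) Z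
    by (intro eventually_periodic_plus eventually_periodic_UN eventually_periodic_sum
        eventually_periodic_set_star) auto
  ultimately show ?thesis by simp
qed

section \<open>Assembly of the statements (a) to (f)\<close>

theorem theorem3p8:
  fixes G :: "'k::finite system"
  assumes "elementary_system G"
  shows "(\<exists>!T. solution G T) \<and>
    (\<forall>T. solution G T \<longrightarrow>
      (\<forall>A\<in>SuP. \<forall>M. \<exists>n0. \<forall>n\<ge>n0. \<forall>i. (Gam G ^^ n) A i \<inter> {0..M} = T i \<inter> {0..M}) \<and>
      (\<forall>i. T i = {} \<longleftrightarrow> (Gam G ^^ CARD('k)) (\<lambda>_. {}) i = {}) \<and>
      (reduced_elementary_system G \<longrightarrow>
        (\<forall>i. strong_class G i \<noteq> {} \<longrightarrow>
          periodic (T i) \<and>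
          ((\<exists>j\<in>strong_class G i. \<exists>u. G j u \<noteq> {} \<and> (\<Sum>l\<in>strong_class G i. u l) \<ge> 2) \<longrightarrow>
            (\<exists>F S. finite F \<and> arith_progression S \<and> T i = F \<union> S))) \<and>
        (\<forall>P\<in>{periodic, eventually_periodic}. \<forall>i Pi QQ.
          strong_class G i = {} \<and>
          P Pi \<and> finite QQ \<and> (\<forall>Q\<in>QQ. \<forall>j. P (Q j)) \<and>
          (\<forall>Y. Gam G Y i = Pi + (\<Union>Q\<in>QQ. \<Sum>j\<in>UNIV. set_star (Q j) (Y j))) \<and>
          (\<forall>j. (i, j) \<in> dep G \<longrightarrow> P (T j)) \<longrightarrow>
          P (T i)) \<and>
        (\<forall>i. min_elem (T i) = min_elem ((Gam G ^^ CARD('k)) (\<lambda>_. {}) i) \<and>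
          int (gap_gcd (T i)) =
            Gcd (\<Union>j\<in>{j. (i, j) \<in> (dep G)\<^sup>*}. \<Union>u.
              (\<lambda>g. int g + (\<Sum>l\<in>UNIV. int (u l) * int (min_elem (T l))) - int (min_elem (T j)))
                ` G j u)) \<and>
        (\<forall>i j. (i, j) \<in> dep G \<longrightarrow> gap_gcd (T i) dvd gap_gcd (T j))))"
proof (intro conjI allI impI ballI)
  show "\<exists>!T. solution G T"
    using solution_exists[OF assms] solution_unique[OF assms] by blast
next
  fix T A :: "'k \<Rightarrow> nat set" and M assume "solution G T" "A \<in> SuP"
  then show "\<exists>n0. \<forall>n\<ge>n0. \<forall>i. (Gam G ^^ n) A i \<inter> {0..M} = T i \<inter> {0..M}"
    using Gam_funpow_agree_solution[OF assms] by blast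
next
  fix T :: "'k \<Rightarrow> nat set" and i assume "solution G T"
  then interpret elementary_solution G T
    using assms by unfold_locales
  show "T i = {} \<longleftrightarrow> (Gam G ^^ CARD('k)) (\<lambda>_. {}) i = {}"
    by (rule empty_iff_funpow_empty)
next
  fix T :: "'k \<Rightarrow> nat set" and P i Pi QQ
  assume T: "solution G T" and P: "P \<in> {periodic, eventually_periodic}"
    and *: "strong_class G i = {} \<and> P Pi \<and> finite QQ \<and> (\<forall>Q\<in>QQ. \<forall>j. P (Q j)) \<and>
      (\<forall>Y. Gam G Y i = Pi + (\<Union>Q\<in>QQ. \<Sum>j\<in>UNIV. set_star (Q j) (Y j))) \<and>
      (\<forall>j. (i, j) \<in> dep G \<longrightarrow> P (T j))"
  have Ti: "T i = Gam G T i"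
    using T by (simp add: solution_def)
  consider "P = periodic" | "P = eventually_periodic"
    using P by blast
  then show "P (T i)"
  proof cases
    case 1
    \<comment> \<open>The solution turns the given form of the equation into a sumset for
      \<open>T i\<close>, and shifting the summand taken from \<open>Pi\<close> shifts the
      total.\<close>
    have "T i = Pi + (\<Union>Q\<in>QQ. \<Sum>j\<in>UNIV. set_star (Q j) (T j))"
      using * Ti by blast
    moreover have "periodic Pi"
      using * 1 by blast
    ultimately show ?thesis
      by (simp only: 1 periodic_plus)
  next
    case 2
    show ?thesis
      unfolding 2 Ti by (rule eventually_periodic_Gam[of G i Pi QQ]) (use * 2 in blast)+
  qed
next
  fix T :: "'k \<Rightarrow> nat set" assume T: "solution G T" and red: "reduced_elementary_system G"
  interpret elementary_solution G T
    using assms T by unfold_locales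
  have "T i \<noteq> {}" for i
    unfolding empty_iff_funpow_empty using red unfolding reduced_elementary_system_def by blast
  then interpret reduced_solution G T
    by unfold_locales
  fix i
  show "periodic (T i)" if "strong_class G i \<noteq> {}"
    using that by (rule periodic_if_strong_class)
  show "\<exists>F S. finite F \<and> arith_progression S \<and> T i = F \<union> S"
    if "\<exists>j\<in>strong_class G i. \<exists>u. G j u \<noteq> {} \<and> (\<Sum>l\<in>strong_class G i. u l) \<ge> 2"
    using that arith_progression_if_branching by blast
  show "min_elem (T i) = min_elem ((Gam G ^^ CARD('k)) (\<lambda>_. {}) i)"
    using T_nonempty by (rule min_elem_funpow)
  show "int (gap_gcd (T i)) =
      Gcd (\<Union>j\<in>{j. (i, j) \<in> (dep G)\<^sup>*}. \<Union>u.
        (\<lambda>g. int g + (\<Sum>l\<in>UNIV. int (u l) * int (min_elem (T l))) - int (min_elem (T j))) ` G j u)"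
    by (rule gap_gcd_eq)
  show "gap_gcd (T i) dvd gap_gcd (T j)" if "(i, j) \<in> dep G" for j
    using that by (rule gap_gcd_dvd_dep)
qed

end
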